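(* Let $(X,d)$ be a complete metric space, let $\mathbb{T}$ be $\mathbb{R}$ or $\mathbb{Z}$, let $\varphi$ be a decay function, and let $S=\{S(t,s)\colon t\geqslant s,\ t,s\in\mathbb{T}\}$ be a $\varphi$-pullback $\kappa$-dissipative evolution process in $X$ with a backwards bounded generalized $\varphi$-pullback attractor $\hat{M}$. Then $S$ has a pullback attractor $\hat{A}$, with $\hat{A}\subset\hat{M}$.
   Context: An evolution process in $X$ is a family $S=\{S(t,s)\colon t\geqslant s,\ t,s\in\mathbb{T}\}$ of continuous maps $X\to X$ with $S(t,t)x=x$ for all $x\in X$, $t\in\mathbb{T}$; $S(t,r)S(r,s)=S(t,s)$ for $t\geqslant r\geqslant s$; and $(t,s,x)\mapsto S(t,s)x$ continuous. A family $\hat{D}=\{D_t\}_{t\in\mathbb{T}}$ consists of nonempty subsets $D_t\subset X$; it is closed (compact) if each $D_t$ is closed (compact), and backwards bounded if $\bigcup_{s\leqslant t}D_s$ is bounded for each $t\in\mathbb{T}$. $\hat A\subset\hat B$ means $A_t\subset B_t$ for all $t$. $\hat{B}$ is invariant (positively invariant) for $S$ if $S(t,s)B_s=B_t$ ($S(t,s)B_s\subset B_t$) for all $t\geqslant s$. The Hausdorff semidistance is $d_H(U,V)=\sup_{u\in U}\inf_{v\in V}d(u,v)$ for nonempty $U,V\subset X$. A family $\hat B$ is pullback attracting if $\lim_{s\to-\infty}d_H(S(t,s)D,B_t)=0$ for each bounded $D\subset X$ and $t\in\mathbb{T}$. A family $\hat A$ is a pullback attractor for $S$ if it is compact, invariant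 for $S$, pullback attracting, and minimal among closed pullback attracting families, i.e. $\hat A\subset\hat C$ for every closed pullback attracting family $\hat C$. A decay function is a decreasing function $\varphi\colon[k,\infty)\to[0,\infty)$, for some constant $k\geqslant 0$, with $\lim_{t\to\infty}\varphi(t)=0$ and $\limsup_{t\to\infty}\frac{\varphi(\omega t+\eta)}{\varphi(\omega t)}<\infty$ for every $\omega>0$ and $\eta\in\mathbb{R}$ (in particular these quotients are understood to be defined for large $t$). The Kuratowski measure of non-compactness of a bounded set $B\subset X$ is $\kappa(B)=\inf\{\delta>0\colon B$ admits a finite cover by sets of diameter $\leqslant\delta\}$. $S$ is $\varphi$-pullback $\kappa$-dissipative if there exists $\omega>0$ such that for every bounded $D\subset X$ and $t\in\mathbb{T}$ there exist $C\geqslant0$ and $\tau_0\geqslant 0$ with $\kappa\big(\bigcup_{\sigma\geqslant\tau}S(t,t-\sigma)D\big)\leqslant C\varphi(\omega\tau)$ for all $\tau\geqslant\tau_0$ ($\sigma,\tau\in\mathbb{T}$). A family $\hat{M}$ is a generalized $\varphi$-pullback attractor for $S$ if it is compact, positively invariant, and there exists $\omega>0$ such that for every bounded $D\subset X$ and $t\in\mathbb{T}$ there exist $C=C(D,t)\geqslant0$, $\tau_0=\tau_0(D,t)\geqslant0$ with $d_H(S(t,t-\tau)D,M_t)\leqslant C\varphi(\omega\tau)$ for all $\tau\geqslant\tau_0$. *)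

theory Defs
  imports "HOL-Analysis.Analysis"
begin

text \<open>
  The time set \<open>T\<close> is a subset of the reals, either all reals or the integers.  Processes
  and families are total functions of real time; only their values at times in \<open>T\<close> (and,
  for processes, at pairs \<open>s \<le> t\<close>) matter.  Continuity and limits in time are taken
  relative to \<open>T\<close>.
\<close>

definition evolution_process :: "real set \<Rightarrow> (real \<Rightarrow> real \<Rightarrow> 'a::metric_space \<Rightarrow> 'a) \<Rightarrow> bool" where
  "evolution_process T S \<longleftrightarrow>
     (\<forall>t\<in>T. \<forall>s\<in>T. s \<le> t \<longrightarrow> continuous_on UNIV (S t s)) \<and>
     (\<forall>t\<in>T. \<forall>x. S t t x = x) \<and>
     (\<forall>t\<in>T. \<forall>r\<in>T. \<forall>s\<in>T. s \<le> r \<longrightarrow> r \<le> t \<longrightarrow> (\<forall>x. S t r (S r s x) = S t s x)) \<and>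
     continuous_on {(t, s, x). t \<in> T \<and> s \<in> T \<and> s \<le> t} (\<lambda>(t, s, x). S t s x)"

definition is_family :: "real set \<Rightarrow> (real \<Rightarrow> 'a set) \<Rightarrow> bool" where
  "is_family T D \<longleftrightarrow> (\<forall>t\<in>T. D t \<noteq> {})"

definition closed_family :: "real set \<Rightarrow> (real \<Rightarrow> 'a::metric_space set) \<Rightarrow> bool" where
  "closed_family T D \<longleftrightarrow> is_family T D \<and> (\<forall>t\<in>T. closed (D t))"

definition compact_family :: "real set \<Rightarrow> (real \<Rightarrow> 'a::metric_space set) \<Rightarrow> bool" where
  "compact_family T D \<longleftrightarrow> is_family T D \<and> (\<forall>t\<in>T. compact (D t))"

definition backwards_bounded :: "real set \<Rightarrow> (real \<Rightarrow> 'a::metric_space set) \<Rightarrow> bool" where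
  "backwards_bounded T D \<longleftrightarrow> (\<forall>t\<in>T. bounded (\<Union>s\<in>{s\<in>T. s \<le> t}. D s))"

definition family_subset :: "real set \<Rightarrow> (real \<Rightarrow> 'a set) \<Rightarrow> (real \<Rightarrow> 'a set) \<Rightarrow> bool" where
  "family_subset T A B \<longleftrightarrow> (\<forall>t\<in>T. A t \<subseteq> B t)"

definition invariant_family :: "real set \<Rightarrow> (real \<Rightarrow> real \<Rightarrow> 'a \<Rightarrow> 'a) \<Rightarrow> (real \<Rightarrow> 'a set) \<Rightarrow> bool" where
  "invariant_family T S B \<longleftrightarrow> (\<forall>t\<in>T. \<forall>s\<in>T. s \<le> t \<longrightarrow> S t s ` B s = B t)"

definition positively_invariant_family ::
    "real set \<Rightarrow> (real \<Rightarrow> real \<Rightarrow> 'a \<Rightarrow> 'a) \<Rightarrow> (real \<Rightarrow> 'a set) \<Rightarrow> bool" where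
  "positively_invariant_family T S B \<longleftrightarrow> (\<forall>t\<in>T. \<forall>s\<in>T. s \<le> t \<longrightarrow> S t s ` B s \<subseteq> B t)"

text \<open>
  The semidistance and the measure of non-compactness take values in \<open>[0, \<infinity>]\<close>, so that the
  supremum over an unbounded set and the infimum over an empty set of radii are \<open>\<infinity>\<close>.
\<close>

definition hausdorff_semidist :: "'a::metric_space set \<Rightarrow> 'a set \<Rightarrow> ennreal" where
  "hausdorff_semidist U V = (SUP u\<in>U. INF v\<in>V. ennreal (dist u v))"

text \<open>
  The library's \<^const>\<open>diameter\<close> is real-valued and only meaningful on bounded sets, hence the
  explicit \<^const>\<open>bounded\<close>.  A set has finite measure of non-compactness iff it is bounded; in
  particular the estimate in \<open>pullback_kappa_dissipative\<close> below includes the boundedness of the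
  union.
\<close>

definition kuratowski :: "'a::metric_space set \<Rightarrow> ennreal" where
  "kuratowski B = Inf {ennreal \<delta> | \<delta>. \<delta> > 0 \<and>
     (\<exists>\<U>. finite \<U> \<and> B \<subseteq> \<Union>\<U> \<and> (\<forall>U\<in>\<U>. bounded U \<and> diameter U \<le> \<delta>))}"

definition pullback_attracting ::
    "real set \<Rightarrow> (real \<Rightarrow> real \<Rightarrow> 'a::metric_space \<Rightarrow> 'a) \<Rightarrow> (real \<Rightarrow> 'a set) \<Rightarrow> bool" where
  "pullback_attracting T S B \<longleftrightarrow>
     (\<forall>D. bounded D \<longrightarrow> (\<forall>t\<in>T.
        ((\<lambda>s. hausdorff_semidist (S t s ` D) (B t)) \<longlongrightarrow> 0) (inf at_bot (principal T))))"

definition pullback_attractor ::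
    "real set \<Rightarrow> (real \<Rightarrow> real \<Rightarrow> 'a::metric_space \<Rightarrow> 'a) \<Rightarrow> (real \<Rightarrow> 'a set) \<Rightarrow> bool" where
  "pullback_attractor T S A \<longleftrightarrow>
     compact_family T A \<and> invariant_family T S A \<and> pullback_attracting T S A \<and>
     (\<forall>C. closed_family T C \<and> pullback_attracting T S C \<longrightarrow> family_subset T A C)"

text \<open>
  A decay function on \<open>[k, \<infinity>)\<close>; values of \<open>\<phi>\<close> below \<open>k\<close> are irrelevant, and the definitions
  using \<open>\<phi>\<close> carry \<open>k\<close> along so as to evaluate it on \<open>[k, \<infinity>)\<close> only.  ``Decreasing'' is read
  in the weak sense.  The quotients must have a nonzero denominator for large \<open>t\<close>.
\<close>

definition decay_function :: "real \<Rightarrow> (real \<Rightarrow> real) \<Rightarrow> bool" where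
  "decay_function k \<phi> \<longleftrightarrow>
     k \<ge> 0 \<and> (\<forall>t\<ge>k. \<phi> t \<ge> 0) \<and> antimono_on {k..} \<phi> \<and> (\<phi> \<longlongrightarrow> 0) at_top \<and>
     (\<forall>\<omega>>0. \<forall>\<eta>.
        (\<forall>\<^sub>F t in at_top. \<phi> (\<omega> * t) \<noteq> 0) \<and>
        Limsup at_top (\<lambda>t. ereal (\<phi> (\<omega> * t + \<eta>) / \<phi> (\<omega> * t))) < \<infinity>)"

definition pullback_kappa_dissipative ::
    "real set \<Rightarrow> real \<Rightarrow> (real \<Rightarrow> real) \<Rightarrow> (real \<Rightarrow> real \<Rightarrow> 'a::metric_space \<Rightarrow> 'a) \<Rightarrow> bool" where
  "pullback_kappa_dissipative T k \<phi> S \<longleftrightarrow>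
     (\<exists>\<omega>>0. \<forall>D. bounded D \<longrightarrow> (\<forall>t\<in>T. \<exists>C\<ge>0. \<exists>\<tau>\<^sub>0\<ge>0. k \<le> \<omega> * \<tau>\<^sub>0 \<and>
        (\<forall>\<tau>\<in>T. \<tau> \<ge> \<tau>\<^sub>0 \<longrightarrow>
           kuratowski (\<Union>\<sigma>\<in>{\<sigma>\<in>T. \<sigma> \<ge> \<tau>}. S t (t - \<sigma>) ` D) \<le> ennreal (C * \<phi> (\<omega> * \<tau>)))))"

definition generalized_pullback_attractor ::
    "real set \<Rightarrow> real \<Rightarrow> (real \<Rightarrow> real) \<Rightarrow> (real \<Rightarrow> real \<Rightarrow> 'a::metric_space \<Rightarrow> 'a) \<Rightarrow>
     (real \<Rightarrow> 'a set) \<Rightarrow> bool" where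
  "generalized_pullback_attractor T k \<phi> S M \<longleftrightarrow>
     compact_family T M \<and> positively_invariant_family T S M \<and>
     (\<exists>\<omega>>0. \<forall>D. bounded D \<longrightarrow> (\<forall>t\<in>T. \<exists>C\<ge>0. \<exists>\<tau>\<^sub>0\<ge>0. k \<le> \<omega> * \<tau>\<^sub>0 \<and>
        (\<forall>\<tau>\<in>T. \<tau> \<ge> \<tau>\<^sub>0 \<longrightarrow>
           hausdorff_semidist (S t (t - \<tau>) ` D) (M t) \<le> ennreal (C * \<phi> (\<omega> * \<tau>)))))"

end

theory Submission
  imports Defs
begin

text \<open>
  Positive invariance makes the compact sets \<open>S t s ` M s\<close> decrease as \<open>s\<close> decreases, so each open
  set that contains their intersection \<open>A t\<close> already contains one of them.  This single compactness
  fact gives nonemptiness and invariance of \<open>A\<close>.  It also gives attraction: if \<open>S t s ` M s\<close> lies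
  in a neighbourhood \<open>U\<close> of \<open>A t\<close>, then the preimage of \<open>U\<close> under \<open>S t s\<close> is a
  neighbourhood of \<open>M s\<close>, which contains \<open>S s r ` D\<close> for small \<open>r\<close>.  For minimality, \<open>A t\<close> lies
  in the image at time \<open>t\<close> of the past of \<open>M\<close>, a bounded set that every attracting family
  attracts.
\<close>

text \<open>This is the candidate attractor \<open>A\<close>. For a compact positively invariant
  \<open>M\<close> it is the pullback omega-limit of \<open>M\<close> along itself: the images are
  nested and already closed, so the usual unions and closures disappear.\<close>

definition pullback_core ::
    "real set \<Rightarrow> (real \<Rightarrow> real \<Rightarrow> 'a \<Rightarrow> 'a) \<Rightarrow> (real \<Rightarrow> 'a set) \<Rightarrow> real \<Rightarrow> 'a set" where
  "pullback_core T S M t = (\<Inter>s\<in>{s\<in>T. s \<le> t}. S t s ` M s)"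

section \<open>Pointwise form of pullback attraction\<close>

lemma hausdorff_semidist_lessD:
  assumes "hausdorff_semidist U V < ennreal e" "u \<in> U"
  shows "\<exists>v\<in>V. dist u v < e"
proof -
  have "(INF v\<in>V. ennreal (dist u v)) \<le> hausdorff_semidist U V"
    unfolding hausdorff_semidist_def using assms(2) by (rule SUP_upper)
  then have "(INF v\<in>V. ennreal (dist u v)) < ennreal e"
    using assms(1) by (rule le_less_trans)
  then show ?thesis
    by (auto simp: INF_less_iff ennreal_less_iff)
qed

lemma hausdorff_semidist_leI:
  assumes "\<And>u. u \<in> U \<Longrightarrow> \<exists>v\<in>V. dist u v \<le> e"
  shows "hausdorff_semidist U V \<le> ennreal e"
  unfolding hausdorff_semidist_def
proof (rule SUP_least)
  fix u assume "u \<in> U"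
  then obtain v where "v \<in> V" "dist u v \<le> e"
    using assms by blast
  then show "(INF v\<in>V. ennreal (dist u v)) \<le> ennreal e"
    by (intro INF_lower2[of v]) (auto intro: ennreal_leI)
qed

text \<open>Trades the \<open>ennreal\<close>-valued limit along a filter for a bound on individual
  points; the arguments about the core use attraction in this form.\<close>

lemma pullback_attracting_iff:
  "pullback_attracting T S B \<longleftrightarrow>
     (\<forall>D. bounded D \<longrightarrow> (\<forall>t\<in>T. \<forall>e>0. \<exists>N. \<forall>s\<in>T. s \<le> N \<longrightarrow> (\<forall>x\<in>D. \<exists>b\<in>B t. dist (S t s x) b < e)))"
    (is "_ \<longleftrightarrow> ?R")
proof
  assume L: "pullback_attracting T S B"
  show ?R
  proof (intro allI impI ballI)
    fix D :: "'a set" and t e :: real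
    assume D: "bounded D" and t: "t \<in> T" and e: "e > 0"
    then have "((\<lambda>s. hausdorff_semidist (S t s ` D) (B t)) \<longlongrightarrow> 0) (inf at_bot (principal T))"
      using L unfolding pullback_attracting_def by blast
    from order_tendstoD(2)[OF this, of "ennreal e"] e
    obtain N where N: "\<And>s. s \<le> N \<Longrightarrow> s \<in> T \<Longrightarrow> hausdorff_semidist (S t s ` D) (B t) < ennreal e"
      by (auto simp: eventually_inf_principal eventually_at_bot_linorder)
    show "\<exists>N. \<forall>s\<in>T. s \<le> N \<longrightarrow> (\<forall>x\<in>D. \<exists>b\<in>B t. dist (S t s x) b < e)"
    proof (intro exI[of _ N] ballI impI)
      fix s x assume "s \<in> T" "s \<le> N" "x \<in> D"
      then show "\<exists>b\<in>B t. dist (S t s x) b < e"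
        using hausdorff_semidist_lessD[OF N] by blast
    qed
  qed
next
  assume R: ?R
  show "pullback_attracting T S B"
    unfolding pullback_attracting_def
  proof (intro allI impI ballI)
    fix D :: "'a set" and t :: real
    assume D: "bounded D" and t: "t \<in> T"
    show "((\<lambda>s. hausdorff_semidist (S t s ` D) (B t)) \<longlongrightarrow> 0) (inf at_bot (principal T))"
    proof (rule order_tendstoI)
      fix a :: ennreal assume "a < 0"
      then show "\<forall>\<^sub>F s in inf at_bot (principal T). a < hausdorff_semidist (S t s ` D) (B t)"
        by simp
    next
      fix a :: ennreal assume "0 < a"
      \<comment> \<open>Strict bounds on points give only a weak bound on their supremum, so the
        radius is chosen strictly below \<open>a\<close>; this also makes it finite when
        \<open>a\<close> is infinite.\<close>
      then obtain b where b: "0 < b" "b < a"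
        using dense by blast
      then obtain e where e: "b = ennreal e" "e > 0"
        by (cases b) auto
      obtain N where N: "\<And>s. s \<in> T \<Longrightarrow> s \<le> N \<Longrightarrow> \<forall>x\<in>D. \<exists>b\<in>B t. dist (S t s x) b < e"
        using R[rule_format, OF D t e(2)] by blast
      have "hausdorff_semidist (S t s ` D) (B t) < a" if "s \<le> N" "s \<in> T" for s
      proof -
        have "hausdorff_semidist (S t s ` D) (B t) \<le> ennreal e"
          using N[OF that(2,1)] by (intro hausdorff_semidist_leI) (auto intro: less_imp_le)
        then show ?thesis
          using b(2) e(1) by simp
      qed
      then show "\<forall>\<^sub>F s in inf at_bot (principal T). hausdorff_semidist (S t s ` D) (B t) < a"
        by (auto simp: eventually_inf_principal eventually_at_bot_linorder)
    qed
  qed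
qed

text \<open>For fixed \<open>D\<close> and \<open>t\<close> the rate
  \<open>C * \<phi> (\<omega> * \<tau>)\<close> tends to 0; the substitution
  \<open>\<tau> = t - s\<close> turns large \<open>\<tau>\<close> into \<open>s\<close> near minus
  infinity.\<close>

lemma generalized_pullback_attractor_imp_attracting:
  assumes T: "T = UNIV \<or> T = \<int>"
    and \<phi>: "(\<phi> \<longlongrightarrow> 0) at_top"
    and M: "generalized_pullback_attractor T k \<phi> S M"
  shows "pullback_attracting T S M"
  unfolding pullback_attracting_iff
proof (intro allI impI ballI)
  fix D :: "'a set" and t e :: real
  assume D: "bounded D" and t: "t \<in> T" and e: "e > 0"
  from M obtain \<omega> where \<omega>: "\<omega> > 0"
    and H: "\<forall>D. bounded D \<longrightarrow> (\<forall>t\<in>T. \<exists>C\<ge>0. \<exists>\<tau>\<^sub>0\<ge>0. k \<le> \<omega> * \<tau>\<^sub>0 \<and>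
        (\<forall>\<tau>\<in>T. \<tau> \<ge> \<tau>\<^sub>0 \<longrightarrow>
           hausdorff_semidist (S t (t - \<tau>) ` D) (M t) \<le> ennreal (C * \<phi> (\<omega> * \<tau>))))"
    unfolding generalized_pullback_attractor_def by (elim conjE exE)
  from H[rule_format, OF D t] obtain C \<tau>0 where "\<forall>\<tau>\<in>T. \<tau> \<ge> \<tau>0 \<longrightarrow>
      hausdorff_semidist (S t (t - \<tau>) ` D) (M t) \<le> ennreal (C * \<phi> (\<omega> * \<tau>))"
    by (elim conjE exE)
  note C = this[rule_format]
  have "LIM \<tau> at_top. \<omega> * \<tau> :> at_top"
    using \<omega> by (intro filterlim_tendsto_pos_mult_at_top[OF tendsto_const]) (auto intro: filterlim_ident)
  from filterlim_compose[OF \<phi> this] have "((\<lambda>\<tau>. C * \<phi> (\<omega> * \<tau>)) \<longlongrightarrow> 0) at_top"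
    by (rule tendsto_mult_right_zero)
  from order_tendstoD(2)[OF this e] obtain \<tau>1 where \<tau>1: "\<And>\<tau>. \<tau> \<ge> \<tau>1 \<Longrightarrow> C * \<phi> (\<omega> * \<tau>) < e"
    by (auto simp: eventually_at_top_linorder)
  show "\<exists>N. \<forall>s\<in>T. s \<le> N \<longrightarrow> (\<forall>x\<in>D. \<exists>b\<in>M t. dist (S t s x) b < e)"
  \<comment> \<open>Below this cutoff \<open>t - s\<close> exceeds both \<open>\<tau>0\<close>,
    where the estimate starts, and \<open>\<tau>1\<close>, where the rate falls below
    \<open>e\<close>.\<close>
  proof (intro exI[of _ "t - max \<tau>0 \<tau>1"] ballI impI)
    fix s x assume s: "s \<in> T" "s \<le> t - max \<tau>0 \<tau>1" and x: "x \<in> D"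
    \<comment> \<open>The estimate is available only at elapsed times in \<open>T\<close>, which is
      closed under subtraction in both cases.\<close>
    have "t - s \<in> T"
      using T t s(1) by auto
    then have "hausdorff_semidist (S t s ` D) (M t) \<le> ennreal (C * \<phi> (\<omega> * (t - s)))"
      using C[of "t - s"] s by simp
    also have "\<dots> < ennreal e"
      using \<tau>1[of "t - s"] s e by (intro ennreal_lessI) auto
    finally show "\<exists>b\<in>M t. dist (S t s x) b < e"
      using x by (intro hausdorff_semidist_lessD) auto
  qed
qed

section \<open>Compact sets and their open neighbourhoods\<close>

lemma compact_chain_subset_open:
  fixes F :: "'i \<Rightarrow> 'a::t2_space set"
  assumes "I \<noteq> {}"
    and F: "\<And>i. i \<in> I \<Longrightarrow> compact (F i)"
    and chain: "\<And>i j. i \<in> I \<Longrightarrow> j \<in> I \<Longrightarrow> F i \<subseteq> F j \<or> F j \<subseteq> F i"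
    and U: "open U" "(\<Inter>i\<in>I. F i) \<subseteq> U"
  shows "\<exists>i\<in>I. F i \<subseteq> U"
proof (rule ccontr)
  assume neg: "\<not> (\<exists>i\<in>I. F i \<subseteq> U)"
  obtain i0 where i0: "i0 \<in> I"
    using assms(1) by blast
  \<comment> \<open>In a chain every finite subfamily has a smallest member. Including
    \<open>F i0\<close> keeps that member inside one fixed compact set.\<close>
  have least: "\<exists>i\<in>I. F i \<subseteq> F i0 \<inter> (\<Inter>j\<in>J. F j)" if "finite J" "J \<subseteq> I" for J
    using that
  proof (induction J rule: finite_induct)
    case empty
    then show ?case using i0 by auto
  next
    case (insert j J)
    then obtain i where "i \<in> I" "F i \<subseteq> F i0 \<inter> (\<Inter>j\<in>J. F j)"
      by auto
    moreover have "F i \<subseteq> F j \<or> F j \<subseteq> F i"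
      using chain \<open>i \<in> I\<close> insert.prems by blast
    ultimately show ?case
      using insert.prems by (elim disjE) (blast intro: bexI[of _ i] bexI[of _ j])+
  qed
  \<comment> \<open>Finite intersection property in the compact set \<open>F i0 - U\<close>: the
    smallest member of a finite subfamily has a point outside \<open>U\<close>, so all members share
    such a point.\<close>
  have "(F i0 - U) \<inter> (\<Inter>i\<in>I. F i) \<noteq> {}"
  proof (rule compact_imp_fip_image)
    show "compact (F i0 - U)"
      using F[OF i0] U(1) by (rule compact_diff)
    show "closed (F i)" if "i \<in> I" for i
      using F[OF that] by (rule compact_imp_closed)
    show "(F i0 - U) \<inter> (\<Inter>j\<in>J. F j) \<noteq> {}" if "finite J" "J \<subseteq> I" for J
    proof -
      obtain i where i: "i \<in> I" "F i \<subseteq> F i0 \<inter> (\<Inter>j\<in>J. F j)"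
        using least[OF \<open>finite J\<close> \<open>J \<subseteq> I\<close>] ..
      then obtain x where "x \<in> F i" "x \<notin> U"
        using neg by blast
      then have "x \<in> (F i0 - U) \<inter> (\<Inter>j\<in>J. F j)"
        using i(2) by auto
      then show ?thesis
        by blast
    qed
  qed
  then show False
    using U(2) by blast
qed

text \<open>The preimage of \<open>U\<close> is an open set around the compact \<open>K\<close>,
  hence contains a neighbourhood of uniform radius. Closeness to \<open>K\<close> is what attraction
  by \<open>M s\<close> supplies.\<close>

lemma compact_image_subset_open_nhd:
  fixes f :: "'a::metric_space \<Rightarrow> 'b::topological_space"
  assumes "continuous_on UNIV f" "compact K" "K \<noteq> {}" "open U" "f ` K \<subseteq> U"
  shows "\<exists>d>0. \<forall>x. (\<exists>z\<in>K. dist x z < d) \<longrightarrow> f x \<in> U"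
proof -
  have "open (f -` U)" "K \<subseteq> f -` U"
    using assms by (auto simp: open_vimage)
  then obtain d where "d > 0" "(\<Union>z\<in>K. ball z d) \<subseteq> f -` U"
    using compact_subset_open_imp_ball_epsilon_subset[OF assms(2)] by blast
  then show ?thesis
    by (intro exI[of _ d]) (auto simp: subset_iff dist_commute)
qed

section \<open>The core of a compact positively invariant family\<close>

context
  fixes T :: "real set"
    and S :: "real \<Rightarrow> real \<Rightarrow> 'a::metric_space \<Rightarrow> 'a"
    and M :: "real \<Rightarrow> 'a set"
  assumes process: "evolution_process T S"
    and compact: "compact_family T M"
    and pos_inv: "positively_invariant_family T S M"
begin

lemma process_continuous: "t \<in> T \<Longrightarrow> s \<in> T \<Longrightarrow> s \<le> t \<Longrightarrow> continuous_on UNIV (S t s)"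
  using process unfolding evolution_process_def by blast

lemma process_comp:
  "t \<in> T \<Longrightarrow> r \<in> T \<Longrightarrow> s \<in> T \<Longrightarrow> s \<le> r \<Longrightarrow> r \<le> t \<Longrightarrow> S t r (S r s x) = S t s x"
  using process unfolding evolution_process_def by blast

lemma process_refl: "t \<in> T \<Longrightarrow> S t t x = x"
  using process unfolding evolution_process_def by blast

lemma compact_member: "t \<in> T \<Longrightarrow> compact (M t)" and member_nonempty: "t \<in> T \<Longrightarrow> M t \<noteq> {}"
  using compact unfolding compact_family_def is_family_def by blast+

lemma process_member: "t \<in> T \<Longrightarrow> s \<in> T \<Longrightarrow> s \<le> t \<Longrightarrow> x \<in> M s \<Longrightarrow> S t s x \<in> M t"
  using pos_inv unfolding positively_invariant_family_def by blast

lemma compact_process_image: "t \<in> T \<Longrightarrow> s \<in> T \<Longrightarrow> s \<le> t \<Longrightarrow> compact (S t s ` M s)"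
  by (meson compact_continuous_image compact_member continuous_on_subset process_continuous subset_UNIV)

text \<open>Factor \<open>S t r\<close> through time \<open>s\<close>: positive invariance carries
  \<open>M r\<close> into \<open>M s\<close> first.\<close>

lemma process_image_mono:
  assumes "t \<in> T" "s \<in> T" "r \<in> T" "r \<le> s" "s \<le> t"
  shows "S t r ` M r \<subseteq> S t s ` M s"
proof
  fix y assume "y \<in> S t r ` M r"
  then obtain m where "m \<in> M r" "y = S t s (S s r m)"
    using process_comp[OF assms(1,2,3,4,5)] by auto
  then show "y \<in> S t s ` M s"
    using process_member[OF assms(2,3,4)] by blast
qed

text \<open>The images form a chain by \<open>process_image_mono\<close>. The lemma is applied to
  the empty set, to the complement of a fibre and to an \<open>e\<close>-neighbourhood of the
  core.\<close>

lemma pullback_core_subset_open: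
  assumes "t \<in> T" "open U" "pullback_core T S M t \<subseteq> U"
  obtains s where "s \<in> T" "s \<le> t" "S t s ` M s \<subseteq> U"
proof -
  have "\<exists>s\<in>{s\<in>T. s \<le> t}. S t s ` M s \<subseteq> U"
  proof (rule compact_chain_subset_open)
    show "S t r ` M r \<subseteq> S t s ` M s \<or> S t s ` M s \<subseteq> S t r ` M r"
      if "r \<in> {s\<in>T. s \<le> t}" "s \<in> {s\<in>T. s \<le> t}" for r s
      using that process_image_mono[OF assms(1)] by (cases "r \<le> s") auto
  qed (use assms compact_process_image in \<open>auto simp: pullback_core_def\<close>)
  then show ?thesis
    using that by blast
qed

lemma pullback_core_subset: "family_subset T (pullback_core T S M) M"
  unfolding family_subset_def
proof (intro ballI subsetI)
  fix t x assume t: "t \<in> T" and "x \<in> pullback_core T S M t"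
  then have "x \<in> S t t ` M t"
    unfolding pullback_core_def by blast
  then show "x \<in> M t"
    using process_refl[OF t] by auto
qed

lemma compact_family_pullback_core: "compact_family T (pullback_core T S M)"
  unfolding compact_family_def is_family_def
proof (intro conjI ballI)
  fix t assume t: "t \<in> T"
  \<comment> \<open>If the core were empty, the choice \<open>U = {}\<close> would make some image
    of a nonempty \<open>M s\<close> empty.\<close>
  show "pullback_core T S M t \<noteq> {}"
    using pullback_core_subset_open[OF t, of "{}"] member_nonempty by auto
  have "closed (pullback_core T S M t)"
    unfolding pullback_core_def
    by (intro closed_INT ballI compact_imp_closed compact_process_image) (use t in auto)
  moreover have "pullback_core T S M t \<subseteq> M t"
    using pullback_core_subset t unfolding family_subset_def by blast
  ultimately show "compact (pullback_core T S M t)"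
    using compact_member[OF t] by (metis compact_Int_closed inf.absorb_iff2)
qed

lemma invariant_family_pullback_core: "invariant_family T S (pullback_core T S M)"
  unfolding invariant_family_def
proof (intro ballI impI)
  fix t s assume ts: "t \<in> T" "s \<in> T" "s \<le> t"
  show "S t s ` pullback_core T S M s = pullback_core T S M t"
  proof (intro equalityI subsetI)
    fix y assume "y \<in> S t s ` pullback_core T S M s"
    then obtain z where z: "z \<in> pullback_core T S M s" "y = S t s z"
      by blast
    show "y \<in> pullback_core T S M t"
      unfolding pullback_core_def
    proof
      fix r assume r: "r \<in> {r\<in>T. r \<le> t}"
      show "y \<in> S t r ` M r"
      proof (cases "r \<le> s")
        case True
        then obtain m where "m \<in> M r" "z = S s r m"
          using z(1) r unfolding pullback_core_def by blast
        then show ?thesis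
          using z(2) True r ts process_comp by auto
      next
        case False
        have "z \<in> M s"
          using z(1) pullback_core_subset ts unfolding family_subset_def by blast
        then have "y \<in> S t s ` M s"
          using z(2) by blast
        then show ?thesis
          using process_image_mono[of t r s] r ts False by auto
      qed
    qed
  next
    fix y assume y: "y \<in> pullback_core T S M t"
    show "y \<in> S t s ` pullback_core T S M s"
    proof (rule ccontr)
      assume neg: "y \<notin> S t s ` pullback_core T S M s"
      \<comment> \<open>If \<open>y\<close> is not reached, the core at time \<open>s\<close> avoids
        the closed fibre over \<open>y\<close>, so some \<open>S s r\<close> M
        r\<open>avoids it too. This contradicts\<close>y\<open>lying in\<close>S t r
        \<open>M r\<close>.\<close>
      have "open (S t s -` (- {y}))"
        using process_continuous[OF ts] by (intro open_vimage) auto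
      moreover have "pullback_core T S M s \<subseteq> S t s -` (- {y})"
        using neg by auto
      ultimately obtain r where r: "r \<in> T" "r \<le> s" "S s r ` M r \<subseteq> S t s -` (- {y})"
        using pullback_core_subset_open ts(2) by blast
      have "y \<in> S t r ` M r"
        using y r ts unfolding pullback_core_def by auto
      then obtain m where "m \<in> M r" "y = S t s (S s r m)"
        using process_comp[OF ts(1,2) r(1,2) ts(3)] by auto
      then show False
        using r(3) by auto
    qed
  qed
qed

lemma pullback_attracting_pullback_core:
  assumes attr: "pullback_attracting T S M"
  shows "pullback_attracting T S (pullback_core T S M)"
  unfolding pullback_attracting_iff
proof (intro allI impI ballI)
  fix D :: "'a set" and t e :: real
  assume D: "bounded D" and t: "t \<in> T" and e: "e > 0"
  define U where "U = (\<Union>a\<in>pullback_core T S M t. ball a e)"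
  have "open U" "pullback_core T S M t \<subseteq> U"
    using e unfolding U_def by auto
  then obtain s where s: "s \<in> T" "s \<le> t" "S t s ` M s \<subseteq> U"
    using pullback_core_subset_open t by blast
  obtain d where d: "d > 0" "\<And>x. (\<exists>z\<in>M s. dist x z < d) \<Longrightarrow> S t s x \<in> U"
    using compact_image_subset_open_nhd[OF process_continuous[OF t s(1,2)]
        compact_member[OF s(1)] member_nonempty[OF s(1)] \<open>open U\<close> s(3)] by blast
  \<comment> \<open>Attraction by \<open>M\<close> is used at the intermediate time
    \<open>s\<close>, with the radius \<open>d\<close> that \<open>S t s\<close> carries into
    \<open>U\<close>.\<close>
  obtain N where N: "\<And>r. r \<in> T \<Longrightarrow> r \<le> N \<Longrightarrow> \<forall>x\<in>D. \<exists>z\<in>M s. dist (S s r x) z < d"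
    using attr[unfolded pullback_attracting_iff, rule_format, OF D s(1) d(1)] by blast
  show "\<exists>N. \<forall>r\<in>T. r \<le> N \<longrightarrow> (\<forall>x\<in>D. \<exists>a\<in>pullback_core T S M t. dist (S t r x) a < e)"
  \<comment> \<open>The bound \<open>s\<close> allows \<open>S t r\<close> to be split at time
    \<open>s\<close>; the bound \<open>N\<close> activates attraction there.\<close>
  proof (intro exI[of _ "min s N"] ballI impI)
    fix r x assume r: "r \<in> T" "r \<le> min s N" and x: "x \<in> D"
    have "S t s (S s r x) \<in> U"
      using N[of r] r x by (intro d(2)) auto
    then have "S t r x \<in> U"
      using process_comp r s t by simp
    then show "\<exists>a\<in>pullback_core T S M t. dist (S t r x) a < e"
      unfolding U_def by (auto simp: dist_commute)
  qed
qed

lemma pullback_core_minimal: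
  assumes unbounded: "\<And>N. \<exists>s\<in>T. s \<le> N"
    and bb: "backwards_bounded T M"
    and C: "closed_family T C" "pullback_attracting T S C"
  shows "family_subset T (pullback_core T S M) C"
  unfolding family_subset_def
proof (intro ballI subsetI)
  fix t x assume t: "t \<in> T" and x: "x \<in> pullback_core T S M t"
  \<comment> \<open>The starting points \<open>m\<close> below vary with \<open>s\<close>;
    collecting them in one bounded set lets a single \<open>N\<close> serve all of them.\<close>
  define D where "D = (\<Union>s\<in>{s\<in>T. s \<le> t}. M s)"
  have D: "bounded D"
    using bb t unfolding backwards_bounded_def D_def by blast
  have "\<exists>c\<in>C t. dist c x < e" if e: "e > 0" for e
  proof -
    obtain N where N: "\<And>s. s \<in> T \<Longrightarrow> s \<le> N \<Longrightarrow> \<forall>y\<in>D. \<exists>c\<in>C t. dist (S t s y) c < e"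
      using C(2)[unfolded pullback_attracting_iff, rule_format, OF D t e] by blast
    obtain s where s: "s \<in> T" "s \<le> min t N"
      using unbounded by blast
    then obtain m where "m \<in> M s" "x = S t s m"
      using x unfolding pullback_core_def by auto
    then show ?thesis
      using N[of s] s unfolding D_def by (auto simp: dist_commute)
  qed
  then have "x \<in> closure (C t)"
    by (simp add: closure_approachable)
  then show "x \<in> C t"
    using C(1) t unfolding closed_family_def by simp
qed

end

theorem theorem2p10:
  fixes T :: "real set"
    and S :: "real \<Rightarrow> real \<Rightarrow> 'a::complete_space \<Rightarrow> 'a"
    and k :: real and \<phi> :: "real \<Rightarrow> real"
    and M :: "real \<Rightarrow> 'a set"
  assumes "T = UNIV \<or> T = \<int>"
    and "decay_function k \<phi>"
    and "evolution_process T S"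
    and "pullback_kappa_dissipative T k \<phi> S"
    and "generalized_pullback_attractor T k \<phi> S M"
    and "backwards_bounded T M"
  shows "\<exists>A. pullback_attractor T S A \<and> family_subset T A M"
proof (intro exI conjI)
  have M: "compact_family T M" "positively_invariant_family T S M"
    using assms(5) unfolding generalized_pullback_attractor_def by blast+
  have "(\<phi> \<longlongrightarrow> 0) at_top"
    using assms(2) unfolding decay_function_def by blast
  then have attr: "pullback_attracting T S M"
    using generalized_pullback_attractor_imp_attracting assms(1,5) by blast
  have unbounded: "\<exists>s\<in>T. s \<le> N" for N
    \<comment> \<open>The floor of \<open>N\<close> is a witness for both the real and the integer
      time set.\<close>
    using assms(1) by (auto intro!: bexI[of _ "of_int \<lfloor>N\<rfloor>"])
  note core = assms(3) M
  show "pullback_attractor T S (pullback_core T S M)"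
    unfolding pullback_attractor_def
    using compact_family_pullback_core[OF core] invariant_family_pullback_core[OF core]
      pullback_attracting_pullback_core[OF core attr]
      pullback_core_minimal[OF core unbounded assms(6)] by blast
  show "family_subset T (pullback_core T S M) M"
    by (rule pullback_core_subset[OF core])
qed

end
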